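(* Let $n\ge3$ and let $T_i=(t_{i1},t_{ia},t_{ib})$, $i=2,3,4$, be triangles in $\mathbb{RH}^n$ satisfying the matching side length conditions $$d(t_{21},t_{2b})=d(t_{31},t_{3a}),\quad d(t_{31},t_{3b})=d(t_{41},t_{4a}),\quad d(t_{41},t_{4b})=d(t_{21},t_{2a}).$$ Let $va_{23},va_{34},va_{42}\in[0,\pi]$ be the hyperbolic angles at the vertices $t_{21},t_{31},t_{41}$ of $T_2,T_3,T_4$ respectively, let $va_{ij}=va_{ji}$, and let $$\mathcal{M}_{CVA}=\begin{pmatrix}1&\cos va_{23}&\cos va_{24}\\ \cos va_{32}&1&\cos va_{34}\\ \cos va_{42}&\cos va_{43}&1\end{pmatrix}.$$ There is a tetrahedron $X=(x_1,x_2,x_3,x_4)$ in $\mathbb{RH}^n$ such that $T_2$ is congruent to $(x_1,x_2,x_3)$, $T_3$ is congruent to $(x_1,x_3,x_4)$ and $T_4$ is congruent to $(x_1,x_4,x_2)$ if and only if $\mathcal{M}_{CVA}$ is positive semidefinite. That condition is equivalent to each of the following three conditions (the third being considered when $\sin va_{23}\sin va_{42}\ne0$): $$\det\mathcal{M}_{CVA}\ge0,$$ $$(\cos va_{34}-\cos va_{23}\cos va_{42})^2\le(1-\cos^2va_{23})(1-\cos^2va_{42}),$$ $$\left(\frac{\cos va_{34}-\cos va_{23}\cos va_{42}}{\sin va_{23}\sin va_{42}}\right)^2\le1.$$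
   Context: $\mathbb{RH}^n$ is real hyperbolic $n$-space with hyperbolic distance $d$. A triangle (tetrahedron) is an ordered triple (quadruple) of distinct points; no nondegeneracy is required. Two ordered tuples are congruent if an isometry of $\mathbb{RH}^n$ takes the $j$-th point of the first to the $j$-th point of the second for every $j$. The hyperbolic angle at a vertex of a triangle is the angle in $[0,\pi]$ between the geodesic segments joining that vertex to the two other vertices. *)

theory Defs
  imports "HOL-Analysis.Analysis"
begin

section \<open>Real hyperbolic space: the hyperboloid model\<close>

text \<open>The ambient space is Minkowski space, a pair consisting of the time coordinate and
  the n space coordinates, where n is the cardinality of the index type.\<close>

type_synonym 'n minkowski = "real \<times> (real ^ 'n)"

definition lorentz :: "'n::finite minkowski \<Rightarrow> 'n minkowski \<Rightarrow> real" where
  "lorentz p q = snd p \<bullet> snd q - fst p * fst q"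

definition RH :: "'n::finite minkowski set" where
  "RH = {p. lorentz p p = - 1 \<and> 0 < fst p}"

definition hyp_dist :: "'n::finite minkowski \<Rightarrow> 'n minkowski \<Rightarrow> real" where
  "hyp_dist p q = arcosh (- lorentz p q)"

text \<open>The restriction of the Lorentz form to the tangent space at a point of the hyperboloid
  (its Lorentz-orthogonal complement) is the Riemannian metric.\<close>

definition unit_tangents :: "'n::finite minkowski \<Rightarrow> 'n minkowski set" where
  "unit_tangents p = {u. lorentz p u = 0 \<and> lorentz u u = 1}"

text \<open>The unit-speed geodesic with initial point \<open>p\<close> and initial velocity \<open>u\<close>.\<close>

definition hyp_geodesic :: "'n::finite minkowski \<Rightarrow> 'n minkowski \<Rightarrow> real \<Rightarrow> 'n minkowski" where
  "hyp_geodesic p u s = cosh s *\<^sub>R p + sinh s *\<^sub>R u"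

text \<open>The initial velocity at \<open>p\<close> of the geodesic segment from \<open>p\<close> to \<open>q\<close>, obtained by solving
  \<open>hyp_geodesic p u (hyp_dist p q) = q\<close> for \<open>u\<close>; see \<open>hyp_dir_unique\<close> below.
  It is meaningful only for distinct \<open>p\<close> and \<open>q\<close>.\<close>

definition hyp_dir :: "'n::finite minkowski \<Rightarrow> 'n minkowski \<Rightarrow> 'n minkowski" where
  "hyp_dir p q = (1 / sinh (hyp_dist p q)) *\<^sub>R (q - cosh (hyp_dist p q) *\<^sub>R p)"

text \<open>The angle at the vertex \<open>p\<close> between the geodesic segments to \<open>q\<close> and to \<open>r\<close>.\<close>

definition hyp_angle ::
  "'n::finite minkowski \<Rightarrow> 'n minkowski \<Rightarrow> 'n minkowski \<Rightarrow> real" where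
  "hyp_angle p q r = arccos (lorentz (hyp_dir p q) (hyp_dir p r))"

definition hyp_isometry :: "('n::finite minkowski \<Rightarrow> 'n minkowski) \<Rightarrow> bool" where
  "hyp_isometry f \<longleftrightarrow> bij_betw f RH RH \<and> (\<forall>p\<in>RH. \<forall>q\<in>RH. hyp_dist (f p) (f q) = hyp_dist p q)"

section \<open>Triangles, tetrahedra and congruence\<close>

definition hyp_triangle :: "'n::finite minkowski list \<Rightarrow> bool" where
  "hyp_triangle T \<longleftrightarrow> length T = 3 \<and> set T \<subseteq> RH \<and> distinct T"

definition hyp_tetrahedron :: "'n::finite minkowski list \<Rightarrow> bool" where
  "hyp_tetrahedron X \<longleftrightarrow> length X = 4 \<and> set X \<subseteq> RH \<and> distinct X"

definition hyp_congruent :: "'n::finite minkowski list \<Rightarrow> 'n minkowski list \<Rightarrow> bool" where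
  "hyp_congruent S T \<longleftrightarrow> (\<exists>f. hyp_isometry f \<and> map f S = T)"

section \<open>The matrix of cosines of vertex angles\<close>

definition pos_semidef :: "real ^ 'm ^ 'm::finite \<Rightarrow> bool" where
  "pos_semidef A \<longleftrightarrow> transpose A = A \<and> (\<forall>v. 0 \<le> v \<bullet> (A *v v))"

definition M_CVA :: "(nat \<Rightarrow> nat \<Rightarrow> real) \<Rightarrow> real ^ 3 ^ 3" where
  "M_CVA va = vector [
     vector [1, cos (va 2 3), cos (va 2 4)],
     vector [cos (va 3 2), 1, cos (va 3 4)],
     vector [cos (va 4 2), cos (va 4 3), 1]]"

section \<open>The model is well defined\<close>

lemma lorentz_commute: "lorentz p q = lorentz q p"
  by (simp add: lorentz_def inner_commute)

lemma lorentz_simps: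
  "lorentz (p + q) r = lorentz p r + lorentz q r"
  "lorentz r (p + q) = lorentz r p + lorentz r q"
  "lorentz (p - q) r = lorentz p r - lorentz q r"
  "lorentz r (p - q) = lorentz r p - lorentz r q"
  "lorentz (c *\<^sub>R p) r = c * lorentz p r"
  "lorentz r (c *\<^sub>R p) = c * lorentz r p"
  by (simp_all add: lorentz_def inner_simps algebra_simps)

lemma lorentz_tangent_pos:
  assumes "p \<in> RH" "lorentz p u = 0" "u \<noteq> 0"
  shows "0 < lorentz u u"
proof -
  have p: "snd p \<bullet> snd p = (fst p)\<^sup>2 - 1" "0 < fst p"
    using assms(1) by (simp_all add: RH_def lorentz_def power2_eq_square)
  have o: "snd p \<bullet> snd u = fst p * fst u"
    using assms(2) by (simp add: lorentz_def)
  have "(snd p \<bullet> snd u)\<^sup>2 \<le> (snd p \<bullet> snd p) * (snd u \<bullet> snd u)"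
    by (rule Cauchy_Schwarz_ineq)
  then have le: "snd u \<bullet> snd u \<le> (fst p)\<^sup>2 * lorentz u u"
    by (simp add: o p lorentz_def power2_eq_square algebra_simps)
  have "snd u \<noteq> 0"
  proof
    assume "snd u = 0"
    with o p have "fst u = 0" by simp
    with \<open>snd u = 0\<close> assms(3) show False by (simp add: prod_eq_iff)
  qed
  then have "0 < snd u \<bullet> snd u" by simp
  with le have "0 < (fst p)\<^sup>2 * lorentz u u" by linarith
  then show ?thesis
    using p by (simp add: zero_less_mult_iff)
qed

lemma lorentz_le: 
  assumes "p \<in> RH" "q \<in> RH"
  shows "lorentz p q \<le> - 1"
proof -
  define a where "a = norm (snd p)"
  define b where "b = norm (snd q)"
  have p: "(fst p)\<^sup>2 = 1 + a\<^sup>2" "0 < fst p" and q: "(fst q)\<^sup>2 = 1 + b\<^sup>2" "0 < fst q"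
    using assms by (simp_all add: RH_def lorentz_def power2_eq_square a_def b_def flip: power2_norm_eq_inner)
  have "(1 + a * b)\<^sup>2 \<le> (1 + a\<^sup>2) * (1 + b\<^sup>2)"
    using zero_le_power2[of "a - b"] by (simp add: power2_eq_square algebra_simps)
  also have "\<dots> = (fst p * fst q)\<^sup>2" by (simp add: p q power_mult_distrib)
  finally have "1 + a * b \<le> fst p * fst q"
    by (rule power2_le_imp_le) (use p q in simp)
  moreover have "snd p \<bullet> snd q \<le> a * b"
    unfolding a_def b_def by (rule norm_cauchy_schwarz)
  ultimately show ?thesis by (simp add: lorentz_def)
qed

lemma lorentz_eq_iff:
  assumes "p \<in> RH" "q \<in> RH"
  shows "lorentz p q = - 1 \<longleftrightarrow> p = q"
proof
  assume e: "lorentz p q = - 1"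
  have s: "lorentz p p = - 1" "lorentz q q = - 1" using assms by (simp_all add: RH_def)
  have "lorentz p (q - p) = 0" "lorentz (q - p) (q - p) = 0"
    using e s by (simp_all add: lorentz_simps lorentz_commute[of q p])
  then show "p = q" using lorentz_tangent_pos[OF assms(1), of "q - p"] by fastforce
next
  assume "p = q" then show "lorentz p q = - 1" using assms by (simp add: RH_def)
qed

lemma cosh_hyp_dist: "p \<in> RH \<Longrightarrow> q \<in> RH \<Longrightarrow> cosh (hyp_dist p q) = - lorentz p q"
  using lorentz_le[of p q] by (simp add: hyp_dist_def)

lemma hyp_dist_nonneg: "p \<in> RH \<Longrightarrow> q \<in> RH \<Longrightarrow> 0 \<le> hyp_dist p q"
  using lorentz_le[of p q] by (simp add: hyp_dist_def)

lemma hyp_dist_eq_0_iff: "p \<in> RH \<Longrightarrow> q \<in> RH \<Longrightarrow> hyp_dist p q = 0 \<longleftrightarrow> p = q"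
  using lorentz_le[of p q] lorentz_eq_iff[of p q] by (auto simp add: hyp_dist_def)

text \<open>The curves \<open>hyp_geodesic p u\<close> are geodesic lines of the metric.\<close>

lemma hyp_geodesic_isometric:
  assumes "p \<in> RH" "u \<in> unit_tangents p"
  shows "hyp_dist (hyp_geodesic p u s) (hyp_geodesic p u t) = \<bar>s - t\<bar>"
proof -
  have "- lorentz (hyp_geodesic p u s) (hyp_geodesic p u t) = cosh (s - t)"
    using assms by (simp add: RH_def unit_tangents_def hyp_geodesic_def lorentz_simps
        lorentz_commute[of u p] cosh_diff)
  also have "\<dots> = cosh \<bar>s - t\<bar>" by simp
  finally show ?thesis by (simp only: hyp_dist_def arcosh_cosh_real abs_ge_zero)
qed

lemma hyp_geodesic_in_RH:
  assumes "p \<in> RH" "u \<in> unit_tangents p"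
  shows "hyp_geodesic p u s \<in> RH"
proof -
  have l: "lorentz (hyp_geodesic p u s) (hyp_geodesic p u s) = - 1"
    using assms cosh_square_eq[of s] by (simp add: RH_def unit_tangents_def hyp_geodesic_def lorentz_simps
        lorentz_commute[of u p] power2_eq_square)
  have p: "(fst p)\<^sup>2 = 1 + snd p \<bullet> snd p" "0 < fst p"
    using assms(1) by (simp_all add: RH_def lorentz_def power2_eq_square)
  have o: "snd p \<bullet> snd u = fst p * fst u" and n: "snd u \<bullet> snd u = 1 + (fst u)\<^sup>2"
    using assms(2) by (simp_all add: unit_tangents_def lorentz_def power2_eq_square)
  have "(snd p \<bullet> snd u)\<^sup>2 \<le> (snd p \<bullet> snd p) * (snd u \<bullet> snd u)"
    by (rule Cauchy_Schwarz_ineq)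
  then have "(fst p * fst u)\<^sup>2 \<le> ((fst p)\<^sup>2 - 1) * (1 + (fst u)\<^sup>2)"
    by (simp add: o n p)
  then have "(fst u)\<^sup>2 < (fst p)\<^sup>2" by (simp add: power_mult_distrib algebra_simps)
  then have u: "\<bar>fst u\<bar> < fst p" using p(2) power2_less_imp_less[of "\<bar>fst u\<bar>" "fst p"] by simp
  have s: "\<bar>sinh s\<bar> \<le> cosh s"
    by (rule power2_le_imp_le) (simp_all add: cosh_square_eq)
  have "\<bar>sinh s * fst u\<bar> \<le> cosh s * \<bar>fst u\<bar>"
    by (simp add: abs_mult mult_right_mono s)
  also have "\<dots> < cosh s * fst p" using u by simp
  finally have "0 < fst (hyp_geodesic p u s)" by (simp add: hyp_geodesic_def abs_if split: if_splits)
  with l show ?thesis by (simp add: RH_def)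
qed

lemma hyp_dir_in_unit_tangents:
  assumes "p \<in> RH" "q \<in> RH" "p \<noteq> q"
  shows "hyp_dir p q \<in> unit_tangents p"
    and "hyp_geodesic p (hyp_dir p q) (hyp_dist p q) = q"
proof -
  let ?d = "hyp_dist p q"
  have d: "sinh ?d \<noteq> 0"
    using hyp_dist_eq_0_iff[of p q] assms by simp
  have s: "lorentz p p = - 1" "lorentz q q = - 1" using assms by (simp_all add: RH_def)
  have c: "lorentz p q = - cosh ?d" using assms by (simp add: cosh_hyp_dist)
  have "lorentz (q - cosh ?d *\<^sub>R p) (q - cosh ?d *\<^sub>R p) = (sinh ?d)\<^sup>2"
    using s c by (simp add: lorentz_simps lorentz_commute[of q p] power2_eq_square
        cosh_square_eq[of ?d, unfolded power2_eq_square])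
  moreover have "lorentz p (q - cosh ?d *\<^sub>R p) = 0" using s c by (simp add: lorentz_simps)
  ultimately show "hyp_dir p q \<in> unit_tangents p"
    using d unfolding unit_tangents_def hyp_dir_def
    by (simp add: lorentz_simps(5,6) power2_eq_square)
  show "hyp_geodesic p (hyp_dir p q) ?d = q"
    using d by (simp add: hyp_geodesic_def hyp_dir_def)
qed

lemma hyp_dir_unique:
  assumes "p \<in> RH" "u \<in> unit_tangents p" "0 < s" "hyp_geodesic p u s = q"
  shows "s = hyp_dist p q" and "u = hyp_dir p q"
proof -
  show s: "s = hyp_dist p q"
    using hyp_geodesic_isometric[OF assms(1,2), of 0 s] assms(3,4) by (simp add: hyp_geodesic_def)
  show "u = hyp_dir p q"
    unfolding hyp_dir_def s[symmetric] using assms(3) by (simp add: assms(4)[symmetric] hyp_geodesic_def)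
qed

lemma unit_tangents_lorentz_le:
  assumes "p \<in> RH" "u \<in> unit_tangents p" "v \<in> unit_tangents p"
  shows "\<bar>lorentz u v\<bar> \<le> 1"
proof -
  have n: "0 \<le> lorentz w w" if "lorentz p w = 0" for w
    using lorentz_tangent_pos[OF assms(1) that] by (cases "w = 0") (auto simp: lorentz_def)
  have "0 \<le> lorentz (u + v) (u + v)" "0 \<le> lorentz (u - v) (u - v)"
    by (rule n; use assms in \<open>simp add: lorentz_simps unit_tangents_def\<close>)+
  then show ?thesis
    using assms by (simp add: lorentz_simps unit_tangents_def lorentz_commute[of v u])
qed

lemma hyp_angle_cos:
  assumes "p \<in> RH" "q \<in> RH" "r \<in> RH" "p \<noteq> q" "p \<noteq> r"
  shows "cos (hyp_angle p q r) = lorentz (hyp_dir p q) (hyp_dir p r)"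
    and "hyp_angle p q r \<in> {0..pi}"
proof -
  have "\<bar>lorentz (hyp_dir p q) (hyp_dir p r)\<bar> \<le> 1"
    using assms by (intro unit_tangents_lorentz_le[of p] hyp_dir_in_unit_tangents)
  then show "cos (hyp_angle p q r) = lorentz (hyp_dir p q) (hyp_dir p r)"
    and "hyp_angle p q r \<in> {0..pi}"
    by (simp_all add: hyp_angle_def abs_le_iff arccos_lbound arccos_ubound)
qed

lemma hyp_dist_commute: "hyp_dist p q = hyp_dist q p"
  by (simp add: hyp_dist_def lorentz_commute)

lemma hyp_dist_triangle:
  assumes "p \<in> RH" "q \<in> RH" "r \<in> RH"
  shows "hyp_dist p r \<le> hyp_dist p q + hyp_dist q r"
proof (cases "p = q \<or> r = q")
  case True
  then show ?thesis using assms hyp_dist_eq_0_iff by fastforce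
next
  case False
  let ?a = "hyp_dist q p" and ?b = "hyp_dist q r"
  let ?u = "hyp_dir q p" and ?v = "hyp_dir q r"
  have u: "?u \<in> unit_tangents q" "hyp_geodesic q ?u ?a = p"
    using assms False by (auto intro: hyp_dir_in_unit_tangents)
  have v: "?v \<in> unit_tangents q" "hyp_geodesic q ?v ?b = r"
    using assms False by (auto intro: hyp_dir_in_unit_tangents)
  have n: "0 \<le> ?a" "0 \<le> ?b" "0 \<le> hyp_dist p r"
    using assms by (auto intro: hyp_dist_nonneg)
  have "lorentz (hyp_geodesic q ?u ?a) (hyp_geodesic q ?v ?b)
      = sinh ?a * sinh ?b * lorentz ?u ?v - cosh ?a * cosh ?b"
    using u(1) v(1) assms(2) by (simp add: RH_def unit_tangents_def hyp_geodesic_def lorentz_simps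
        lorentz_commute[of ?u q])
  then have "cosh (hyp_dist p r) = cosh ?a * cosh ?b + sinh ?a * sinh ?b * (- lorentz ?u ?v)"
    using assms by (simp add: cosh_hyp_dist u(2) v(2))
  also have "\<dots> \<le> cosh ?a * cosh ?b + sinh ?a * sinh ?b * 1"
    using unit_tangents_lorentz_le[OF assms(2) u(1) v(1)] n
    by (intro add_left_mono mult_left_mono) auto
  also have "\<dots> = cosh (?a + ?b)" by (simp add: cosh_add)
  finally have "hyp_dist p r \<le> ?a + ?b"
    using n cosh_real_nonneg_le_iff by auto
  then show ?thesis by (simp add: hyp_dist_commute[of q p])
qed

end

theory Submission
  imports Defs
begin

text \<open>The directions from the vertex \<open>x1\<close> to the other vertices of a tetrahedron are unit vectors of
  the Euclidean tangent space at \<open>x1\<close>, and their Gram matrix consists of the cosines of the vertex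
  angles; hence it is positive semidefinite. Conversely, since the tangent space has dimension at
  least three, the determinant condition allows one to choose three unit tangent vectors with the
  prescribed Gram matrix, and moving along them by the prescribed side lengths gives the tetrahedron.
  By the law of cosines its faces have the side lengths of the given triangles, and tuples of points
  with equal mutual distances are congruent: the isometry is a product of hyperplane reflections,
  each of which moves one further point into place.\<close>

section \<open>Reflections and congruence\<close>

text \<open>The reflection in the Lorentz-orthogonal hyperplane of \<open>w\<close>, meaningful when
  \<open>lorentz w w\<close> is nonzero. For \<open>w = p - q\<close> with distinct
  \<open>p\<close>, \<open>q\<close> in \<open>RH\<close> the mirror is their perpendicular
  bisector.\<close>

definition lorentz_reflection :: "'n::finite minkowski \<Rightarrow> 'n minkowski \<Rightarrow> 'n minkowski" where
  "lorentz_reflection w x = x - (2 * lorentz w x / lorentz w w) *\<^sub>R w"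

lemma lorentz_lorentz_reflection:
  "lorentz w w \<noteq> 0 \<Longrightarrow>
    lorentz (lorentz_reflection w x) (lorentz_reflection w y) = lorentz x y"
  by (simp add: lorentz_reflection_def lorentz_simps lorentz_commute[of x w] field_simps)

lemma lorentz_reflection_involution:
  assumes "lorentz w w \<noteq> 0"
  shows "lorentz_reflection w (lorentz_reflection w x) = x"
proof -
  have "lorentz w (lorentz_reflection w x) = - lorentz w x"
    using assms by (simp add: lorentz_reflection_def lorentz_simps)
  then show ?thesis
    by (simp add: lorentz_reflection_def[of w "lorentz_reflection w x"])
      (simp add: lorentz_reflection_def)
qed

text \<open>Of the two sheets of the hyperboloid, the wrong one is excluded by a sign: otherwise
  \<open>- y\<close> lies in \<open>RH\<close>, and \<open>lorentz_le\<close> makes its product with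
  \<open>q\<close> negative. This keeps reflections from exchanging the sheets.\<close>

lemma in_RH_if_lorentz_neg:
  assumes "lorentz y y = - 1" "q \<in> RH" "lorentz y q < 0"
  shows "y \<in> RH"
proof (rule ccontr)
  assume "y \<notin> RH"
  then have "fst y \<le> 0" using assms(1) by (simp add: RH_def)
  moreover have "fst y \<noteq> 0"
  proof
    assume "fst y = 0"
    then have "snd y \<bullet> snd y = - 1" using assms(1) by (simp add: lorentz_def)
    then show False using inner_ge_zero[of "snd y"] by linarith
  qed
  ultimately have "- y \<in> RH" using assms(1) by (simp add: RH_def lorentz_def)
  from lorentz_le[OF this assms(2)] have "1 \<le> lorentz y q" by (simp add: lorentz_def)
  with assms(3) show False by simp
qed

lemma lorentz_diff_pos:
  assumes "p \<in> RH" "q \<in> RH" "p \<noteq> q"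
  shows "0 < lorentz (p - q) (p - q)"
  using assms lorentz_le[of p q] lorentz_eq_iff[of p q]
  by (simp add: lorentz_simps RH_def lorentz_commute[of q p])

lemma lorentz_reflection_swap:
  assumes "p \<in> RH" "q \<in> RH" "p \<noteq> q"
  shows "lorentz_reflection (p - q) p = q"
proof -
  have "2 * lorentz (p - q) p = lorentz (p - q) (p - q)"
    using assms by (simp add: lorentz_simps RH_def lorentz_commute[of q p])
  with lorentz_diff_pos[OF assms] show ?thesis by (simp add: lorentz_reflection_def)
qed

lemma lorentz_reflection_in_RH:
  assumes "p \<in> RH" "q \<in> RH" "p \<noteq> q" "x \<in> RH"
  shows "lorentz_reflection (p - q) x \<in> RH"
proof (rule in_RH_if_lorentz_neg[OF _ assms(2)])
  have n: "lorentz (p - q) (p - q) \<noteq> 0" using lorentz_diff_pos[OF assms(1-3)] by simp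
  show "lorentz (lorentz_reflection (p - q) x) (lorentz_reflection (p - q) x) = - 1"
    using assms(4) by (simp add: lorentz_lorentz_reflection[OF n] RH_def)
  \<comment> \<open>As \<open>q\<close> is the mirror image of \<open>p\<close>, invariance of the
    form reduces the sign test to \<open>lorentz x p\<close>.\<close>
  have "lorentz (lorentz_reflection (p - q) x) q = lorentz x p"
    using lorentz_lorentz_reflection[OF n, of x p] by (simp add: lorentz_reflection_swap assms)
  then show "lorentz (lorentz_reflection (p - q) x) q < 0"
    using lorentz_le[OF assms(4,1)] by simp
qed

lemma hyp_isometry_lorentz_reflection:
  assumes "p \<in> RH" "q \<in> RH" "p \<noteq> q"
  shows "hyp_isometry (lorentz_reflection (p - q))"
proof -
  have n: "lorentz (p - q) (p - q) \<noteq> 0" using lorentz_diff_pos[OF assms] by simp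
  have "bij_betw (lorentz_reflection (p - q)) RH RH"
    by (rule bij_betw_byWitness[where f' = "lorentz_reflection (p - q)"])
      (auto simp: lorentz_reflection_involution[OF n] lorentz_reflection_in_RH[OF assms])
  then show ?thesis
    by (simp add: hyp_isometry_def hyp_dist_def lorentz_lorentz_reflection[OF n])
qed

lemma hyp_dist_eq_iff_lorentz_eq:
  assumes "p \<in> RH" "q \<in> RH" "p' \<in> RH" "q' \<in> RH"
  shows "hyp_dist p q = hyp_dist p' q' \<longleftrightarrow> lorentz p q = lorentz p' q'"
proof
  assume "hyp_dist p q = hyp_dist p' q'"
  then have "cosh (hyp_dist p q) = cosh (hyp_dist p' q')" by simp
  then show "lorentz p q = lorentz p' q'" using assms by (simp add: cosh_hyp_dist)
qed (simp add: hyp_dist_def)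

lemma hyp_isometry_id: "hyp_isometry (\<lambda>x. x)"
  unfolding hyp_isometry_def using bij_betw_id[of RH] by (simp add: id_def)

lemma hyp_isometry_in_RH: "hyp_isometry f \<Longrightarrow> x \<in> RH \<Longrightarrow> f x \<in> RH"
  by (auto simp: hyp_isometry_def bij_betw_def)

lemma hyp_isometry_comp:
  "hyp_isometry f \<Longrightarrow> hyp_isometry g \<Longrightarrow> hyp_isometry (f \<circ> g)"
  using hyp_isometry_in_RH[of g] by (auto simp: hyp_isometry_def intro: bij_betw_trans)

lemma hyp_isometry_lorentz:
  assumes "hyp_isometry f" "x \<in> RH" "y \<in> RH"
  shows "lorentz (f x) (f y) = lorentz x y"
proof -
  have "hyp_dist (f x) (f y) = hyp_dist x y" using assms by (simp add: hyp_isometry_def)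
  then show ?thesis using hyp_isometry_in_RH[OF assms(1)] assms(2,3)
    by (simp add: hyp_dist_eq_iff_lorentz_eq)
qed

text \<open>Induction on appending a point: once \<open>f\<close> carries \<open>S\<close> to
  \<open>T\<close>, the reflection exchanging \<open>f p\<close> and \<open>q\<close> puts the new
  point into place without disturbing \<open>T\<close>.\<close>

lemma hyp_congruent_if_hyp_dist_eq:
  assumes "list_all2 (\<lambda>x x'. x \<in> RH \<and> x' \<in> RH) S T"
    and "\<And>i j. i < length S \<Longrightarrow> j < i \<Longrightarrow> hyp_dist (S ! i) (S ! j) = hyp_dist (T ! i) (T ! j)"
  shows "hyp_congruent S T"
  using assms
proof (induction S arbitrary: T rule: rev_induct)
  case Nil
  then show ?case using hyp_isometry_id by (auto simp: hyp_congruent_def)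
next
  case (snoc p S T')
  obtain q T where T': "T' = T @ [q]" and ST: "list_all2 (\<lambda>x x'. x \<in> RH \<and> x' \<in> RH) S T"
    and p: "p \<in> RH" and q: "q \<in> RH"
    using snoc.prems(1) by (auto simp: list_all2_append1 list_all2_Cons1)
  have len: "length S = length T" using ST by (rule list_all2_lengthD)
  have "hyp_dist (S ! i) (S ! j) = hyp_dist (T ! i) (T ! j)" if "i < length S" "j < i" for i j
    using snoc.prems(2)[of i j] that len by (simp add: T' nth_append)
  then have "hyp_congruent S T" by (rule snoc.IH[OF ST])
  then obtain f where f: "hyp_isometry f" "map f S = T"
    unfolding hyp_congruent_def by blast
  have d: "lorentz (f p) y = lorentz q y" "y \<in> RH" if y: "y \<in> set T" for y
  proof -
    obtain j where j: "j < length T" "y = T ! j" using y by (auto simp: in_set_conv_nth)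
    have jR: "S ! j \<in> RH" "T ! j \<in> RH" using ST j len by (auto simp: list_all2_conv_all_nth)
    have "hyp_dist p (S ! j) = hyp_dist q (T ! j)"
      using snoc.prems(2)[of "length S" j] j len by (simp add: T' nth_append)
    then have "lorentz p (S ! j) = lorentz q y"
      using p q jR j by (simp add: hyp_dist_eq_iff_lorentz_eq)
    moreover have "f (S ! j) = y" using j len nth_map[of j S f] by (simp add: f(2))
    ultimately show "lorentz (f p) y = lorentz q y"
      using hyp_isometry_lorentz[OF f(1) p jR(1)] by simp
    show "y \<in> RH" using jR j by simp
  qed
  have fp: "f p \<in> RH" using f(1) p by (rule hyp_isometry_in_RH)
  show ?case
  proof (cases "f p = q")
    case True
    then have "map f (S @ [p]) = T'" using f(2) by (simp add: T')
    with f(1) show ?thesis unfolding hyp_congruent_def by blast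
  next
    case False
    let ?r = "lorentz_reflection (f p - q)"
    \<comment> \<open>The earlier point \<open>y\<close> is equidistant from \<open>f p\<close> and
      \<open>q\<close>, hence lies on the mirror.\<close>
    have "?r y = y" if "y \<in> set T" for y
      using d[OF that] by (simp add: lorentz_reflection_def lorentz_simps)
    then have "map (?r \<circ> f) S = T"
      unfolding map_map[symmetric] f(2) by (simp add: map_idI)
    then have "map (?r \<circ> f) (S @ [p]) = T'"
      using lorentz_reflection_swap[OF fp q False] by (simp add: T')
    moreover have "hyp_isometry (?r \<circ> f)"
      by (intro hyp_isometry_comp hyp_isometry_lorentz_reflection fp q False f)
    ultimately show ?thesis unfolding hyp_congruent_def by blast
  qed
qed

section \<open>Angles\<close>

text \<open>Although \<open>f\<close> need not be linear, expanding \<open>hyp_dir\<close> expresses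
  the angle through Lorentz products of the three points alone, and \<open>f\<close> preserves
  these.\<close>

lemma hyp_isometry_hyp_angle:
  assumes "hyp_isometry f" "p \<in> RH" "q \<in> RH" "r \<in> RH"
  shows "hyp_angle (f p) (f q) (f r) = hyp_angle p q r"
  using hyp_isometry_lorentz[OF assms(1)] assms
  by (simp add: hyp_angle_def hyp_dir_def lorentz_simps hyp_dist_def)

text \<open>This is the usual law, with \<open>lorentz q r\<close> in place of minus the cosh of the
  third side. Writing \<open>q\<close> and \<open>r\<close> as points on geodesics from
  \<open>p\<close>, the mixed terms vanish because directions are orthogonal to
  \<open>p\<close>.\<close>

lemma hyp_law_of_cosines:
  assumes "p \<in> RH" "q \<in> RH" "r \<in> RH" "p \<noteq> q" "p \<noteq> r"
  shows "lorentz q r = sinh (hyp_dist p q) * sinh (hyp_dist p r) * cos (hyp_angle p q r)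
    - cosh (hyp_dist p q) * cosh (hyp_dist p r)"
proof -
  let ?u = "hyp_dir p q" and ?v = "hyp_dir p r"
  have u: "?u \<in> unit_tangents p" "hyp_geodesic p ?u (hyp_dist p q) = q"
    and v: "?v \<in> unit_tangents p" "hyp_geodesic p ?v (hyp_dist p r) = r"
    using assms hyp_dir_in_unit_tangents by blast+
  have "lorentz (hyp_geodesic p ?u a) (hyp_geodesic p ?v b)
      = sinh a * sinh b * lorentz ?u ?v - cosh a * cosh b" for a b
    using u(1) v(1) assms(1) by (simp add: RH_def unit_tangents_def hyp_geodesic_def lorentz_simps
        lorentz_commute[of ?u p])
  from this[of "hyp_dist p q" "hyp_dist p r"] show ?thesis
    using assms by (simp add: u(2) v(2) hyp_angle_cos)
qed

lemma hyp_congruent_SAS: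
  assumes T: "hyp_triangle [p, q, r]" and R: "{p', q', r'} \<subseteq> RH"
    and d: "hyp_dist p q = hyp_dist p' q'" "hyp_dist p r = hyp_dist p' r'"
    and "cos (hyp_angle p q r) = cos (hyp_angle p' q' r')"
  shows "hyp_congruent [p, q, r] [p', q', r']"
proof (rule hyp_congruent_if_hyp_dist_eq)
  \<comment> \<open>Equal side lengths carry nondegeneracy over to the primed points, so that their
    angle at \<open>p'\<close> is meaningful.\<close>
  have "p' \<noteq> q'" "p' \<noteq> r'"
    using T R d hyp_dist_eq_0_iff[of p q] hyp_dist_eq_0_iff[of p r]
      hyp_dist_eq_0_iff[of p' q'] hyp_dist_eq_0_iff[of p' r']
    by (auto simp: hyp_triangle_def)
  then have "lorentz q r = lorentz q' r'"
    using assms by (simp add: hyp_triangle_def hyp_law_of_cosines[of p q r]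
        hyp_law_of_cosines[of p' q' r'])
  then have "hyp_dist q r = hyp_dist q' r'" by (simp add: hyp_dist_def)
  then show "hyp_dist ([p, q, r] ! i) ([p, q, r] ! j) = hyp_dist ([p', q', r'] ! i) ([p', q', r'] ! j)"
    if "i < length [p, q, r]" "j < i" for i j
    using that d
    by (auto simp: less_Suc_eq hyp_dist_commute[of q p] hyp_dist_commute[of q' p']
        hyp_dist_commute[of r p] hyp_dist_commute[of r q] hyp_dist_commute[of r' p']
        hyp_dist_commute[of r' q'])
qed (use T R in \<open>simp add: hyp_triangle_def\<close>)

lemma hyp_congruent_distinct:
  assumes "hyp_congruent S T" "set S \<subseteq> RH" "distinct S"
  shows "distinct T"
  using assms by (auto simp: hyp_congruent_def hyp_isometry_def bij_betw_def distinct_map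
      intro: inj_on_subset)

lemma hyp_congruent_hyp_angle:
  assumes "hyp_congruent [p, q, r] [p', q', r']" "hyp_triangle [p, q, r]"
  shows "hyp_angle p' q' r' = hyp_angle p q r"
  using assms by (auto simp: hyp_congruent_def hyp_triangle_def hyp_isometry_hyp_angle)

section \<open>Correlation matrices of size three\<close>

text \<open>The discriminant condition for a binary form. The test vectors \<open>(- D, A)\<close>
  and \<open>(B, - D)\<close> give \<open>A\<close> times and \<open>B\<close> times the
  claim.\<close>

lemma quadratic_form_nonneg_imp:
  fixes A B D :: real
  assumes "\<And>y z. 0 \<le> A * y\<^sup>2 + B * z\<^sup>2 + 2 * D * y * z"
  shows "D\<^sup>2 \<le> A * B"
proof -
  have A: "0 \<le> A" and B: "0 \<le> B" using assms[of 1 0] assms[of 0 1] by simp_all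
  have 1: "0 \<le> A * (A * B - D\<^sup>2)"
    using assms[of "- D" A] by (simp add: algebra_simps power2_eq_square)
  have 2: "0 \<le> B * (A * B - D\<^sup>2)"
    using assms[of B "- D"] by (simp add: algebra_simps power2_eq_square)
  consider "0 < A" | "0 < B" | "A = 0" "B = 0" using A B by linarith
  then show ?thesis
  proof cases
    \<comment> \<open>Only the mixed term is left, and at \<open>(1, - D)\<close> it is minus twice
      the square of \<open>D\<close>.\<close>
    case 3
    with assms[of 1 "- D"] show ?thesis by (simp add: power2_eq_square)
  qed (use 1 2 in \<open>simp_all add: zero_le_mult_iff\<close>)
qed

lemma M_CVA_quadratic_form:
  fixes v :: "real ^ 3"
  assumes "\<And>i j. va i j = va j i"
  shows "v \<bullet> (M_CVA va *v v) = (v $ 1)\<^sup>2 + (v $ 2)\<^sup>2 + (v $ 3)\<^sup>2 + 2 * cos (va 2 3) * v $ 1 * v $ 2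
    + 2 * cos (va 4 2) * v $ 1 * v $ 3 + 2 * cos (va 3 4) * v $ 2 * v $ 3"
  using assms[of 2 4] assms[of 3 2] assms[of 4 3]
  by (simp add: M_CVA_def inner_vec_def matrix_vector_mult_def sum_3 power2_eq_square algebra_simps)

lemma transpose_M_CVA:
  assumes "\<And>i j. va i j = va j i"
  shows "transpose (M_CVA va) = M_CVA va"
  using assms[of 2 4] assms[of 3 2] assms[of 4 3]
  by (simp add: M_CVA_def transpose_def vec_eq_iff forall_3)

text \<open>The right-hand side is the determinant of the Schur complement of the first diagonal
  entry, which links the determinant to the second condition.\<close>

lemma det_M_CVA:
  assumes "\<And>i j. va i j = va j i"
  shows "det (M_CVA va) = (1 - (cos (va 2 3))\<^sup>2) * (1 - (cos (va 4 2))\<^sup>2)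
    - (cos (va 3 4) - cos (va 2 3) * cos (va 4 2))\<^sup>2"
  using assms[of 2 4] assms[of 3 2] assms[of 4 3]
  by (simp add: M_CVA_def det_3 power2_eq_square algebra_simps)

lemma pos_semidef_M_CVA_imp:
  assumes sym: "\<And>i j. va i j = va j i" and "pos_semidef (M_CVA va)"
  shows "(cos (va 3 4) - cos (va 2 3) * cos (va 4 2))\<^sup>2
    \<le> (1 - (cos (va 2 3))\<^sup>2) * (1 - (cos (va 4 2))\<^sup>2)"
proof (rule quadratic_form_nonneg_imp)
  fix y z :: real
  let ?a = "cos (va 2 3)" and ?b = "cos (va 4 2)" and ?c = "cos (va 3 4)"
  \<comment> \<open>The first coordinate minimizes the form for given \<open>y\<close> and \<open>z\<close>.\<close>
  let ?v = "vector [- (?a * y + ?b * z), y, z] :: real ^ 3"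
  have "0 \<le> ?v \<bullet> (M_CVA va *v ?v)" using assms(2) by (simp add: pos_semidef_def)
  also have "\<dots> = (1 - ?a\<^sup>2) * y\<^sup>2 + (1 - ?b\<^sup>2) * z\<^sup>2 + 2 * (?c - ?a * ?b) * y * z"
    by (simp add: M_CVA_quadratic_form[where va = va, OF sym] power2_eq_square algebra_simps)
  finally show "0 \<le> \<dots>" .
qed

text \<open>A Cholesky factorization: the vectors have coordinates \<open>(1, 0, 0)\<close>,
  \<open>(a, s, 0)\<close> and \<open>(b, y, z)\<close> along three axes. The product
  \<open>c\<close> determines \<open>y\<close> when \<open>s\<close> is nonzero, unit length
  determines \<open>s\<close> and \<open>z\<close>, and \<open>ineq\<close> makes the radicand of
  \<open>z\<close> nonnegative.\<close>

lemma unit_vectors_with_inner: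
  fixes a b c :: real
  assumes "3 \<le> CARD('n::finite)" "\<bar>a\<bar> \<le> 1" "\<bar>b\<bar> \<le> 1"
    and ineq: "(c - a * b)\<^sup>2 \<le> (1 - a\<^sup>2) * (1 - b\<^sup>2)"
  obtains u v w :: "real ^ 'n::finite"
  where "u \<bullet> u = 1" "v \<bullet> v = 1" "w \<bullet> w = 1" "u \<bullet> v = a" "u \<bullet> w = b" "v \<bullet> w = c"
proof -
  obtain N where "card N = 3" "N \<subseteq> (UNIV :: 'n set)"
    using obtain_subset_with_card_n[OF assms(1)] by metis
  then obtain i j k where ijk: "i \<noteq> j" "i \<noteq> k" "j \<noteq> (k :: 'n)"
    by (auto simp: card_3_iff)
  define s where "s = sqrt (1 - a\<^sup>2)"
  have s2: "s * s = 1 - a\<^sup>2" using assms(2) by (simp add: s_def abs_square_le_1)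
  \<comment> \<open>If \<open>s = 0\<close> then \<open>c = a * b\<close>, so the junk value \<open>y = 0\<close> is the right one.\<close>
  define y where "y = (c - a * b) / s"
  have sy: "s * y = c - a * b"
    using ineq s2 by (cases "s = 0") (simp_all add: y_def)
  have "y\<^sup>2 \<le> 1 - b\<^sup>2"
  proof (cases "s = 0")
    case True
    then show ?thesis using assms(3) by (simp add: y_def abs_square_le_1)
  next
    case False
    then have "0 < s\<^sup>2" by simp
    moreover have "s\<^sup>2 * y\<^sup>2 \<le> s\<^sup>2 * (1 - b\<^sup>2)"
      using ineq by (simp add: s2 power2_eq_square[of s] flip: sy) (simp add: power_mult_distrib s2 power2_eq_square[of s])
    ultimately show ?thesis by simp
  qed
  define z where "z = sqrt (1 - b\<^sup>2 - y\<^sup>2)"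
  have z2: "z * z = 1 - b\<^sup>2 - y\<^sup>2" using \<open>y\<^sup>2 \<le> 1 - b\<^sup>2\<close> by (simp add: z_def)
  let ?e = "\<lambda>i. axis i 1 :: real ^ 'n"
  show thesis
  proof (rule that)
    show "?e i \<bullet> ?e i = 1" by (simp add: inner_axis_axis)
    show "(a *\<^sub>R ?e i + s *\<^sub>R ?e j) \<bullet> (a *\<^sub>R ?e i + s *\<^sub>R ?e j) = 1"
      using ijk s2 by (simp add: inner_axis_axis inner_simps power2_eq_square)
    show "(b *\<^sub>R ?e i + y *\<^sub>R ?e j + z *\<^sub>R ?e k) \<bullet> (b *\<^sub>R ?e i + y *\<^sub>R ?e j + z *\<^sub>R ?e k) = 1"
      using ijk z2 by (simp add: inner_axis_axis inner_simps power2_eq_square)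
    show "?e i \<bullet> (a *\<^sub>R ?e i + s *\<^sub>R ?e j) = a" "?e i \<bullet> (b *\<^sub>R ?e i + y *\<^sub>R ?e j + z *\<^sub>R ?e k) = b"
      using ijk by (simp_all add: inner_axis_axis inner_simps)
    show "(a *\<^sub>R ?e i + s *\<^sub>R ?e j) \<bullet> (b *\<^sub>R ?e i + y *\<^sub>R ?e j + z *\<^sub>R ?e k) = c"
      using ijk sy by (simp add: inner_axis_axis inner_simps mult.commute)
  qed
qed

section \<open>The tetrahedron\<close>

lemma pos_semidef_M_CVA_hyp_angle:
  assumes sym: "\<And>i j. va i j = va j i" and "hyp_tetrahedron [x1, x2, x3, x4]"
    and "va 2 3 = hyp_angle x1 x2 x3" "va 3 4 = hyp_angle x1 x3 x4" "va 4 2 = hyp_angle x1 x4 x2"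
  shows "pos_semidef (M_CVA va)"
  unfolding pos_semidef_def
proof (intro conjI allI)
  show "transpose (M_CVA va) = M_CVA va" by (rule transpose_M_CVA[where va = va, OF sym])
  fix v :: "real ^ 3"
  have x: "x1 \<in> RH" "x2 \<in> RH" "x3 \<in> RH" "x4 \<in> RH" "x1 \<noteq> x2" "x1 \<noteq> x3" "x1 \<noteq> x4"
    using assms(2) by (auto simp: hyp_tetrahedron_def)
  let ?u = "hyp_dir x1"
  have u: "lorentz x1 (?u y) = 0" "lorentz (?u y) (?u y) = 1" if "y \<in> {x2, x3, x4}" for y
    using hyp_dir_in_unit_tangents(1)[of x1 y] x that by (auto simp: unit_tangents_def)
  let ?w = "v $ 1 *\<^sub>R ?u x2 + v $ 2 *\<^sub>R ?u x3 + v $ 3 *\<^sub>R ?u x4"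
  \<comment> \<open>The form at \<open>v\<close> is the Lorentz square of \<open>?w\<close>, a
    tangent vector at \<open>x1\<close>, where the Lorentz form is positive definite.\<close>
  have "lorentz x1 ?w = 0" using u by (simp add: lorentz_simps)
  then have "0 \<le> lorentz ?w ?w"
    using lorentz_tangent_pos[OF x(1), of ?w] by (cases "?w = 0") (auto simp: lorentz_def)
  also have "lorentz ?w ?w = v \<bullet> (M_CVA va *v v)"
    using u x by (simp add: M_CVA_quadratic_form[where va = va, OF sym] lorentz_simps assms(3-5) hyp_angle_cos
        lorentz_commute[of "?u x3" "?u x2"] lorentz_commute[of "?u x4" "?u x2"]
        lorentz_commute[of "?u x4" "?u x3"] power2_eq_square algebra_simps)
  finally show "0 \<le> v \<bullet> (M_CVA va *v v)" .
qed

text \<open>At the base point \<open>(1, 0)\<close> the tangent vectors are the pairs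
  \<open>(0, x)\<close>, with the Euclidean inner product on \<open>x\<close>, so Euclidean unit
  vectors serve directly as initial directions.\<close>

lemma ex_hyp_points_from_origin:
  fixes c a b d :: real
  assumes "3 \<le> CARD('n::finite)" "\<bar>a\<bar> \<le> 1" "\<bar>b\<bar> \<le> 1"
    and "(c - a * b)\<^sup>2 \<le> (1 - a\<^sup>2) * (1 - b\<^sup>2)" and "0 < r" "0 < s" "0 < t"
  obtains p q1 q2 q3 :: "'n::finite minkowski"
  where "{p, q1, q2, q3} \<subseteq> RH"
    "hyp_dist p q1 = r" "hyp_dist p q2 = s" "hyp_dist p q3 = t"
    "cos (hyp_angle p q1 q2) = a" "cos (hyp_angle p q2 q3) = c" "cos (hyp_angle p q3 q1) = b"
proof -
  obtain u v w :: "real ^ 'n" where uvw: "u \<bullet> u = 1" "v \<bullet> v = 1" "w \<bullet> w = 1"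
    "u \<bullet> v = a" "u \<bullet> w = b" "v \<bullet> w = c"
    using unit_vectors_with_inner[OF assms(1-4)] by metis
  let ?p = "(1, 0) :: 'n minkowski"
  have p: "?p \<in> RH" by (simp add: RH_def lorentz_def)
  define g where "g x l = hyp_geodesic ?p (0, x) l" for x :: "real ^ 'n" and l
  have tan: "(0, x) \<in> unit_tangents ?p" if "x \<bullet> x = 1" for x :: "real ^ 'n"
    using that by (simp add: unit_tangents_def lorentz_def)
  have RH: "g x l \<in> RH" if "x \<bullet> x = 1" for x l
    unfolding g_def by (rule hyp_geodesic_in_RH[OF p tan[OF that]])
  have d: "hyp_dist ?p (g x l) = l" "hyp_dir ?p (g x l) = (0, x)" if "x \<bullet> x = 1" "0 < l" for x l
    using hyp_dir_unique[OF p tan[OF that(1)] that(2), of "g x l"] by (simp_all add: g_def)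
  have ang: "cos (hyp_angle ?p (g x l) (g y m)) = x \<bullet> y"
    if "x \<bullet> x = 1" "0 < l" "y \<bullet> y = 1" "0 < m" for x y l m
  proof -
    \<comment> \<open>Positive lengths keep these points off the base point, so the angle is given
      by the directions.\<close>
    have "?p \<noteq> g x l" "?p \<noteq> g y m"
      using d(1)[OF that(1,2)] d(1)[OF that(3,4)] that hyp_dist_eq_0_iff[OF p p] by auto
    then show ?thesis
      using that by (simp add: hyp_angle_cos(1)[OF p RH RH] d lorentz_def)
  qed
  show thesis
    by (rule that[of ?p "g u r" "g v s" "g w t"])
      (use uvw assms(5-7) in \<open>simp_all add: p RH d ang inner_commute[of w u]\<close>)
qed

theorem corollary6p12:
  fixes t21 t2a t2b t31 t3a t3b t41 t4a t4b :: "'n::finite minkowski"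
    and va :: "nat \<Rightarrow> nat \<Rightarrow> real"
  assumes "3 \<le> CARD('n)"
    and "hyp_triangle [t21, t2a, t2b]"
    and "hyp_triangle [t31, t3a, t3b]"
    and "hyp_triangle [t41, t4a, t4b]"
    and "hyp_dist t21 t2b = hyp_dist t31 t3a"
    and "hyp_dist t31 t3b = hyp_dist t41 t4a"
    and "hyp_dist t41 t4b = hyp_dist t21 t2a"
    and "va 2 3 = hyp_angle t21 t2a t2b"
    and "va 3 4 = hyp_angle t31 t3a t3b"
    and "va 4 2 = hyp_angle t41 t4a t4b"
    and "\<And>i j. va i j = va j i"
  shows "((\<exists>x1 x2 x3 x4. hyp_tetrahedron [x1, x2, x3, x4] \<and>
             hyp_congruent [t21, t2a, t2b] [x1, x2, x3] \<and>
             hyp_congruent [t31, t3a, t3b] [x1, x3, x4] \<and>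
             hyp_congruent [t41, t4a, t4b] [x1, x4, x2])
           \<longleftrightarrow> pos_semidef (M_CVA va))
    \<and> (pos_semidef (M_CVA va) \<longleftrightarrow> 0 \<le> det (M_CVA va))
    \<and> (pos_semidef (M_CVA va) \<longleftrightarrow>
           (cos (va 3 4) - cos (va 2 3) * cos (va 4 2))\<^sup>2
             \<le> (1 - (cos (va 2 3))\<^sup>2) * (1 - (cos (va 4 2))\<^sup>2))
    \<and> (sin (va 2 3) * sin (va 4 2) \<noteq> 0 \<longrightarrow>
         (pos_semidef (M_CVA va) \<longleftrightarrow>
           ((cos (va 3 4) - cos (va 2 3) * cos (va 4 2)) / (sin (va 2 3) * sin (va 4 2)))\<^sup>2 \<le> 1))"
proof -
  let ?a = "cos (va 2 3)" and ?b = "cos (va 4 2)" and ?c = "cos (va 3 4)"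
  let ?tetra = "\<exists>x1 x2 x3 x4. hyp_tetrahedron [x1, x2, x3, x4] \<and>
             hyp_congruent [t21, t2a, t2b] [x1, x2, x3] \<and>
             hyp_congruent [t31, t3a, t3b] [x1, x3, x4] \<and>
             hyp_congruent [t41, t4a, t4b] [x1, x4, x2]"
  let ?ineq = "(?c - ?a * ?b)\<^sup>2 \<le> (1 - ?a\<^sup>2) * (1 - ?b\<^sup>2)"
  note sym = assms(11)
  note T = assms(2-4)
  have psd: "pos_semidef (M_CVA va)" if "?tetra"
  proof -
    from that obtain x1 x2 x3 x4 where X: "hyp_tetrahedron [x1, x2, x3, x4]"
      and C: "hyp_congruent [t21, t2a, t2b] [x1, x2, x3]"
        "hyp_congruent [t31, t3a, t3b] [x1, x3, x4]"
        "hyp_congruent [t41, t4a, t4b] [x1, x4, x2]"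
      by blast
    show ?thesis
      by (rule pos_semidef_M_CVA_hyp_angle[where va = va, OF sym X])
        (simp_all add: assms(8-10) hyp_congruent_hyp_angle[OF C(1) T(1)]
          hyp_congruent_hyp_angle[OF C(2) T(2)] hyp_congruent_hyp_angle[OF C(3) T(3)])
  qed
  have tetra: "?tetra" if ineq: "?ineq"
  proof -
    have pos: "0 < hyp_dist p q" if "p \<in> RH" "q \<in> RH" "p \<noteq> q" for p q :: "'n minkowski"
      using hyp_dist_nonneg[OF that(1,2)] hyp_dist_eq_0_iff[OF that(1,2)] that(3) by linarith
    have len: "0 < hyp_dist t21 t2a" "0 < hyp_dist t31 t3a" "0 < hyp_dist t41 t4a"
      using T by (auto simp: hyp_triangle_def intro!: pos)
    obtain x1 x2 x3 x4 :: "'n minkowski" where X: "{x1, x2, x3, x4} \<subseteq> RH"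
      and d: "hyp_dist x1 x2 = hyp_dist t21 t2a" "hyp_dist x1 x3 = hyp_dist t31 t3a"
        "hyp_dist x1 x4 = hyp_dist t41 t4a"
      and a: "cos (hyp_angle x1 x2 x3) = ?a" "cos (hyp_angle x1 x3 x4) = ?c"
        "cos (hyp_angle x1 x4 x2) = ?b"
      using ex_hyp_points_from_origin[OF assms(1) abs_cos_le_one abs_cos_le_one ineq len]
      by metis
    \<comment> \<open>The choice of \<open>d\<close> fixes only the first side of each triangle at
      its vertex; the matching conditions supply the second.\<close>
    have C: "hyp_congruent [t21, t2a, t2b] [x1, x2, x3]"
        "hyp_congruent [t31, t3a, t3b] [x1, x3, x4]"
        "hyp_congruent [t41, t4a, t4b] [x1, x4, x2]"
      using X d a assms(5-10)
      by (intro hyp_congruent_SAS T; simp)+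
    \<comment> \<open>Any two of the four vertices lie on one of these three faces.\<close>
    have "distinct [x1, x2, x3]" "distinct [x1, x3, x4]" "distinct [x1, x4, x2]"
      using C[THEN hyp_congruent_distinct] T by (simp_all only: hyp_triangle_def)
    then have "hyp_tetrahedron [x1, x2, x3, x4]"
      using X by (auto simp: hyp_tetrahedron_def)
    with C show ?thesis by blast
  qed
  have det: "0 \<le> det (M_CVA va) \<longleftrightarrow> ?ineq" by (simp add: det_M_CVA[where va = va, OF sym])
  have quot: "((?c - ?a * ?b) / (sin (va 2 3) * sin (va 4 2)))\<^sup>2 \<le> 1 \<longleftrightarrow> ?ineq"
    if "sin (va 2 3) * sin (va 4 2) \<noteq> 0"
  proof -
    have "0 < (sin (va 2 3) * sin (va 4 2))\<^sup>2" using that by simp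
    then show ?thesis
      by (simp only: power_divide pos_divide_le_eq mult_1)
        (simp add: power_mult_distrib flip: sin_squared_eq)
  qed
  \<comment> \<open>The implications form a cycle: semidefiniteness gives \<open>?ineq\<close>,
    which gives the tetrahedron, which gives semidefiniteness. Thus \<open>?ineq\<close> implies
    semidefiniteness by way of the geometry.\<close>
  show ?thesis
    using psd tetra det quot pos_semidef_M_CVA_imp[where va = va, OF sym] by blast
qed

end
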